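(* Suppose that the following statement (A) is true. (A) For every $n\geq 1$ and all holomorphic function-germs $f,g\colon(\mathbb{C}^n,0)\to (\mathbb{C},0)$, not identically zero: if there is a germ of homeomorphism $\varphi\colon(\mathbb{C}^n,0)\to (\mathbb{C}^n,0)$ such that $f=g\circ \varphi$, then $f_*^{-1}(1)$ and $g_*^{-1}(1)$ have the same homology. Then the following statement (B) is true. (B) For every $n\geq 1$ and all reduced holomorphic function-germs $f,g\colon(\mathbb{C}^n,0)\to (\mathbb{C},0)$: if there is a germ of homeomorphism $\varphi\colon(\mathbb{C}^n,0)\to (\mathbb{C}^n,0)$ such that $f=g\circ \varphi$, then $m(V(f),0)=m(V(g),0)$.
   Context: A holomorphic function-germ $f\colon(\mathbb{C}^n,0)\to(\mathbb{C},0)$, not identically zero, is written $f=f_m+f_{m+1}+\cdots$, where each $f_j$ is identically zero or a homogeneous polynomial of degree $j$, and $f_m\neq 0$. Then $m=\mathrm{ord}_0 f$, and $f_*:=f_m$ is called the initial form of $f$; $f_*^{-1}(1)=\{x\in\mathbb{C}^n: f_*(x)=1\}$. $(V(f),0)$ is the germ at $0$ of the zero set of $f$. A germ is reduced if it is not identically zero and has no repeated irreducible factor in the ring of convergent power series. When $f$ is reduced, the multiplicity of $V(f)$ at the origin is $m(V(f),0):=\mathrm{ord}_0 f$. Two spaces have the same homology if their integral singular homology groups are isomorphic in every degree. *)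

theory Defs
  imports
    "HOL-Analysis.Analysis"
    "HOL-Algebra.Ring_Divisibility"
    "HOL-Homology.Homology_Groups"
begin

text \<open>
  The dimension \<open>n\<close> is quantified inside the two statements being compared, so it cannot be a type.
  As in the library's \<^const>\<open>Euclidean_space\<close>, the space of dimension \<open>n\<close> consists of the sequences
  vanishing from index \<open>n\<close> on. It carries the subspace topology of the product topology on
  \<^typ>\<open>nat \<Rightarrow> complex\<close>, which is its usual topology.
\<close>

definition cspace :: "nat \<Rightarrow> (nat \<Rightarrow> complex) set" where
  "cspace n = {x. \<forall>i\<ge>n. x i = 0}"

abbreviation origin :: "nat \<Rightarrow> complex" where
  "origin \<equiv> (\<lambda>_. 0)"

definition nbhd0 :: "nat \<Rightarrow> (nat \<Rightarrow> complex) set \<Rightarrow> bool" where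
  "nbhd0 n U \<longleftrightarrow> openin (top_of_set (cspace n)) U \<and> origin \<in> U"

definition polydisc :: "nat \<Rightarrow> real \<Rightarrow> (nat \<Rightarrow> complex) set" where
  "polydisc n r = {x \<in> cspace n. \<forall>i<n. norm (x i) < r}"


definition multi_indices :: "nat \<Rightarrow> (nat \<Rightarrow> nat) set" where
  "multi_indices n = {\<alpha>. \<forall>i\<ge>n. \<alpha> i = 0}"

definition mdeg :: "nat \<Rightarrow> (nat \<Rightarrow> nat) \<Rightarrow> nat" where
  "mdeg n \<alpha> = (\<Sum>i<n. \<alpha> i)"

definition mon :: "nat \<Rightarrow> (nat \<Rightarrow> nat) \<Rightarrow> (nat \<Rightarrow> complex) \<Rightarrow> complex" where
  "mon n \<alpha> x = (\<Prod>i<n. x i ^ \<alpha> i)"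

text \<open>
  The ring of convergent power series in \<open>n\<close> variables. A series is its coefficient family, extended
  by zero outside \<^term>\<open>multi_indices n\<close>, so that equality of series is equality of functions.
\<close>

definition conv_series :: "nat \<Rightarrow> ((nat \<Rightarrow> nat) \<Rightarrow> complex) ring" where
  "conv_series n =
    \<lparr> carrier = {c. (\<forall>\<alpha>. \<alpha> \<notin> multi_indices n \<longrightarrow> c \<alpha> = 0) \<and>
                    (\<exists>r>0. \<forall>x\<in>polydisc n r. (\<lambda>\<alpha>. c \<alpha> * mon n \<alpha> x) summable_on multi_indices n)},
      mult = (\<lambda>c d \<gamma>. \<Sum>(\<alpha>, \<beta>) \<in> {(\<alpha>, \<beta>). \<alpha> \<in> multi_indices n \<and> \<beta> \<in> multi_indices n \<and>
                                          (\<forall>i. \<alpha> i + \<beta> i = \<gamma> i)}. c \<alpha> * d \<beta>),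
      one = (\<lambda>\<alpha>. if \<alpha> = (\<lambda>_. 0) then 1 else 0),
      ring.zero = (\<lambda>_. 0),
      add = (\<lambda>c d \<alpha>. c \<alpha> + d \<alpha>) \<rparr>"


text \<open>
  Germs at the origin are represented by functions. All notions below depend only on the values
  on a neighbourhood of the origin in \<^term>\<open>cspace n\<close>.
\<close>

definition has_expansion ::
    "nat \<Rightarrow> ((nat \<Rightarrow> complex) \<Rightarrow> complex) \<Rightarrow> ((nat \<Rightarrow> nat) \<Rightarrow> complex) \<Rightarrow> bool" where
  "has_expansion n f c \<longleftrightarrow> c \<in> carrier (conv_series n) \<and>
     (\<exists>r>0. \<forall>x\<in>polydisc n r. ((\<lambda>\<alpha>. c \<alpha> * mon n \<alpha> x) has_sum f x) (multi_indices n))"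

definition holo_germ :: "nat \<Rightarrow> ((nat \<Rightarrow> complex) \<Rightarrow> complex) \<Rightarrow> bool" where
  "holo_germ n f \<longleftrightarrow> (\<exists>c. has_expansion n f c) \<and> f origin = 0"

definition nonzero_germ :: "nat \<Rightarrow> ((nat \<Rightarrow> complex) \<Rightarrow> complex) \<Rightarrow> bool" where
  "nonzero_germ n f \<longleftrightarrow> \<not> (\<exists>U. nbhd0 n U \<and> (\<forall>x\<in>U. f x = 0))"

definition taylor :: "nat \<Rightarrow> ((nat \<Rightarrow> complex) \<Rightarrow> complex) \<Rightarrow> (nat \<Rightarrow> nat) \<Rightarrow> complex" where
  "taylor n f = (THE c. has_expansion n f c)"

definition hom_part :: "nat \<Rightarrow> ((nat \<Rightarrow> complex) \<Rightarrow> complex) \<Rightarrow> nat \<Rightarrow> (nat \<Rightarrow> complex) \<Rightarrow> complex" where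
  "hom_part n f j x = (\<Sum>\<alpha> \<in> {\<alpha> \<in> multi_indices n. mdeg n \<alpha> = j}. taylor n f \<alpha> * mon n \<alpha> x)"

definition ord0 :: "nat \<Rightarrow> ((nat \<Rightarrow> complex) \<Rightarrow> complex) \<Rightarrow> nat" where
  "ord0 n f = (LEAST m. \<exists>x\<in>cspace n. hom_part n f m x \<noteq> 0)"

definition initial_form :: "nat \<Rightarrow> ((nat \<Rightarrow> complex) \<Rightarrow> complex) \<Rightarrow> (nat \<Rightarrow> complex) \<Rightarrow> complex" where
  "initial_form n f = hom_part n f (ord0 n f)"

definition initial_fibre :: "nat \<Rightarrow> ((nat \<Rightarrow> complex) \<Rightarrow> complex) \<Rightarrow> (nat \<Rightarrow> complex) set" where
  "initial_fibre n f = {x \<in> cspace n. initial_form n f x = 1}"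

definition reduced_germ :: "nat \<Rightarrow> ((nat \<Rightarrow> complex) \<Rightarrow> complex) \<Rightarrow> bool" where
  "reduced_germ n f \<longleftrightarrow> nonzero_germ n f \<and>
     \<not> (\<exists>p \<in> carrier (conv_series n). ring_irreducible\<^bsub>conv_series n\<^esub> p \<and>
          (p \<otimes>\<^bsub>conv_series n\<^esub> p) divides\<^bsub>conv_series n\<^esub> taylor n f)"

text \<open>
  The multiplicity at the origin of the hypersurface germ \<open>V(f)\<close>, given by a reduced equation \<open>f\<close>.
\<close>

definition mult_V :: "nat \<Rightarrow> ((nat \<Rightarrow> complex) \<Rightarrow> complex) \<Rightarrow> nat" where
  "mult_V n f = ord0 n f"

text \<open>
  There is a germ of homeomorphism \<open>\<phi>\<close> fixing the origin with \<open>f = g \<circ> \<phi>\<close> as germs. The identity is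
  required on the whole domain \<open>U\<close> of a representative, which may be shrunk.
\<close>

definition top_right_equiv ::
    "nat \<Rightarrow> ((nat \<Rightarrow> complex) \<Rightarrow> complex) \<Rightarrow> ((nat \<Rightarrow> complex) \<Rightarrow> complex) \<Rightarrow> bool" where
  "top_right_equiv n f g \<longleftrightarrow>
     (\<exists>U V \<phi> \<psi>. nbhd0 n U \<and> nbhd0 n V \<and> homeomorphism U V \<phi> \<psi> \<and> \<phi> origin = origin \<and>
        (\<forall>x\<in>U. f x = g (\<phi> x)))"

definition same_homology :: "'a topology \<Rightarrow> 'b topology \<Rightarrow> bool" where
  "same_homology X Y \<longleftrightarrow> (\<forall>p. homology_group p X \<cong> homology_group p Y)"

end

theory Submission
  imports Defs
begin

text \<open>
  Suppose \<open>m = ord f < l = ord g\<close>. Statement (A) does not require reduced germs, so it may be applied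
  to the germs \<open>f(x)\<^sup>2 + s\<^sup>k t\<close> and \<open>g(x)\<^sup>2 + s\<^sup>k t\<close> in two more variables, where \<open>k = 2m\<close>; they are again
  related by a homeomorphism. Since \<open>2m < k + 1 < 2l\<close>, their initial forms are \<open>f\<^sub>*\<^sup>2\<close> and \<open>s\<^sup>k t\<close>. The fibre
  \<open>f\<^sub>*\<^sup>2 = 1\<close> is disconnected, because it is separated by the sign of \<open>f\<^sub>*\<close>, whereas \<open>s\<^sup>k t = 1\<close> is path
  connected, so that their zeroth homology groups differ.
\<close>

subsection \<open>Homogeneous components of a power series\<close>

text \<open>The coefficients are a parameter here, whereas \<open>hom_part\<close> obtains them from
  the definite description in \<open>taylor\<close>. This makes homogeneous parts available before
  uniqueness of the expansion is known.\<close>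

definition hom_poly :: "nat \<Rightarrow> ((nat \<Rightarrow> nat) \<Rightarrow> complex) \<Rightarrow> nat \<Rightarrow> (nat \<Rightarrow> complex) \<Rightarrow> complex" where
  "hom_poly n c j x = (\<Sum>\<alpha> \<in> {\<alpha> \<in> multi_indices n. mdeg n \<alpha> = j}. c \<alpha> * mon n \<alpha> x)"

lemma le_mdeg: "i < n \<Longrightarrow> \<alpha> i \<le> mdeg n \<alpha>"
  unfolding mdeg_def by (rule member_le_sum) auto

lemma finite_mdeg_eq: "finite {\<alpha> \<in> multi_indices n. mdeg n \<alpha> = j}"
proof (rule finite_subset)
  show "{\<alpha> \<in> multi_indices n. mdeg n \<alpha> = j}
      \<subseteq> {\<alpha>. \<forall>i. (i \<in> {..<n} \<longrightarrow> \<alpha> i \<in> {..j}) \<and> (i \<notin> {..<n} \<longrightarrow> \<alpha> i = 0)}"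
    by (auto simp: multi_indices_def le_mdeg)
qed (intro finite_set_of_finite_funs finite_lessThan finite_atMost)

lemma mon_scale: "mon n \<alpha> (\<lambda>i. t * x i) = t ^ mdeg n \<alpha> * mon n \<alpha> x"
  by (simp add: mon_def mdeg_def power_mult_distrib prod.distrib power_sum)

lemma hom_poly_scale: "hom_poly n c j (\<lambda>i. t * x i) = hom_poly n c j x * t ^ j"
  unfolding hom_poly_def sum_distrib_right by (rule sum.cong) (auto simp: mon_scale)

lemma hom_poly_diff: "hom_poly n (\<lambda>\<alpha>. c \<alpha> - d \<alpha>) j x = hom_poly n c j x - hom_poly n d j x"
  by (simp add: hom_poly_def sum_subtractf left_diff_distrib)

lemma continuous_on_hom_poly: "continuous_on S (hom_poly n c j)"
  unfolding hom_poly_def[abs_def] mon_def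
  by (intro continuous_intros continuous_on_product_then_coordinatewise)

lemma cspace_scale: "x \<in> cspace n \<Longrightarrow> (\<lambda>i. t * x i) \<in> cspace n"
  by (simp add: cspace_def)

text \<open>An unconditionally convergent sum may be grouped freely; here the groups are the finite
  sets of multi-indices of equal degree.\<close>

lemma sums_hom_poly:
  assumes "((\<lambda>\<alpha>. c \<alpha> * mon n \<alpha> x) has_sum s) (multi_indices n)"
  shows "(\<lambda>j. hom_poly n c j x) sums s"
proof -
  let ?B = "\<lambda>j. {\<alpha> \<in> multi_indices n. mdeg n \<alpha> = j}"
  have "((\<lambda>(j, \<alpha>). c \<alpha> * mon n \<alpha> x) has_sum s) (Sigma UNIV ?B)
      \<longleftrightarrow> ((\<lambda>\<alpha>. c \<alpha> * mon n \<alpha> x) has_sum s) (multi_indices n)"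
    by (rule has_sum_reindex_bij_witness[where i = "\<lambda>\<alpha>. (mdeg n \<alpha>, \<alpha>)" and j = snd]) auto
  with assms have "((\<lambda>(j, \<alpha>). c \<alpha> * mon n \<alpha> x) has_sum s) (Sigma UNIV ?B)" by simp
  then have "((\<lambda>j. hom_poly n c j x) has_sum s) UNIV"
    by (rule has_sum_SigmaD) (auto simp: hom_poly_def intro: has_sum_finite finite_mdeg_eq)
  then show ?thesis by (rule has_sum_imp_sums)
qed

lemma ray_in_polydisc:
  assumes "x \<in> cspace n" "r > 0"
  obtains s :: real where "s > 0" "\<And>t. norm t < s \<Longrightarrow> (\<lambda>i. t * x i) \<in> polydisc n r"
proof
  \<comment> \<open>The summand 1 makes the bound strict and keeps \<open>M\<close> positive even
    when all coordinates vanish.\<close>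
  define M where "M = 1 + (\<Sum>i<n. norm (x i))"
  have M: "norm (x i) < M" if "i < n" for i
  proof -
    have "norm (x i) \<le> (\<Sum>i<n. norm (x i))" by (rule member_le_sum) (use that in auto)
    then show "norm (x i) < M" unfolding M_def by linarith
  qed
  have M0: "M > 0" unfolding M_def by (intro add_pos_nonneg sum_nonneg) auto
  show "r / M > 0" using assms(2) M0 by simp
  show "(\<lambda>i. t * x i) \<in> polydisc n r" if "norm t < r / M" for t
  proof -
    have "norm (t * x i) < r" if i: "i < n" for i
    proof -
      have "norm t * norm (x i) \<le> norm t * M" using M[OF i] by (simp add: mult_left_mono)
      also have "\<dots> < r" using \<open>norm t < r / M\<close> M0 by (simp add: field_simps)
      finally show ?thesis by (simp add: norm_mult)
    qed
    then show ?thesis using assms(1) by (simp add: polydisc_def cspace_scale)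
  qed
qed

lemma has_expansionD:
  assumes "has_expansion n f c"
  obtains r where "r > 0" "\<And>x. x \<in> polydisc n r \<Longrightarrow> ((\<lambda>\<alpha>. c \<alpha> * mon n \<alpha> x) has_sum f x) (multi_indices n)"
  using assms unfolding has_expansion_def by auto

lemma has_expansion_outside: "has_expansion n f c \<Longrightarrow> \<alpha> \<notin> multi_indices n \<Longrightarrow> c \<alpha> = 0"
  unfolding has_expansion_def conv_series_def by auto

lemma has_expansionI:
  assumes "r > 0" "\<And>x. x \<in> polydisc n r \<Longrightarrow> ((\<lambda>\<alpha>. c \<alpha> * mon n \<alpha> x) has_sum f x) (multi_indices n)"
    and "\<And>\<alpha>. \<alpha> \<notin> multi_indices n \<Longrightarrow> c \<alpha> = 0"
  shows "has_expansion n f c"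
  using assms unfolding has_expansion_def conv_series_def by (auto dest: has_sum_imp_summable)

text \<open>Restriction to the complex line through \<open>x\<close> turns the germ into a power
  series in one variable whose coefficients are the values at \<open>x\<close> of the homogeneous
  parts. Order and initial form are read off from such restrictions throughout.\<close>

lemma sums_along_ray:
  assumes "has_expansion n f c" "x \<in> cspace n"
  obtains s :: real where "s > 0"
    "\<And>t. norm t < s \<Longrightarrow> (\<lambda>j. hom_poly n c j x * t ^ j) sums f (\<lambda>i. t * x i)"
proof -
  obtain r where r: "r > 0"
    "\<And>x. x \<in> polydisc n r \<Longrightarrow> ((\<lambda>\<alpha>. c \<alpha> * mon n \<alpha> x) has_sum f x) (multi_indices n)"
    using has_expansionD[OF assms(1)] by blast
  obtain s :: real where "s > 0" "\<And>t. norm t < s \<Longrightarrow> (\<lambda>i. t * x i) \<in> polydisc n r"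
    using ray_in_polydisc[OF assms(2) r(1)] by blast
  then show thesis
    using that[of s] sums_hom_poly[OF r(2)] by (simp flip: hom_poly_scale)
qed

section \<open>Leading coefficients of one-variable power series as limits\<close>

lemma powser_tendsto_coeff:
  fixes a :: "nat \<Rightarrow> 'a::{real_normed_field,banach}"
  assumes "s > 0" "\<And>t. norm t < s \<Longrightarrow> (\<lambda>j. a j * t ^ j) sums F t" "\<And>j. j < m \<Longrightarrow> a j = 0"
  shows "(\<lambda>t. F t / t ^ m) \<midarrow>0\<rightarrow> a m"
proof -
  \<comment> \<open>For \<open>m > 0\<close> the quotient at \<open>t = 0\<close> is the default
    value of division by zero, so the identity is claimed only off the origin; the limit is
    insensitive to this.\<close>
  have "(\<lambda>j. a (j + m) * t ^ j) sums (F t / t ^ m)" if t: "t \<noteq> 0" "norm t < s" for t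
  proof -
    have "(\<lambda>j. a (j + m) * t ^ (j + m)) sums (F t - (\<Sum>j<m. a j * t ^ j))"
      using sums_split_initial_segment assms(2)[OF t(2)] by blast
    then have "(\<lambda>j. a (j + m) * t ^ (j + m)) sums F t" using assms(3) by simp
    then have "(\<lambda>j. a (j + m) * t ^ (j + m) / t ^ m) sums (F t / t ^ m)" by (rule sums_divide)
    then show ?thesis using t by (simp add: power_add)
  qed
  then have "(\<lambda>t. F t / t ^ m) \<midarrow>0\<rightarrow> a (0 + m)"
    by (rule powser_limit_0_strong[OF assms(1)])
  then show ?thesis by simp
qed

text \<open>A converse of the preceding lemma: a finite limit of \<open>F t / t ^ m\<close> excludes
  lower terms, which are removed one by one starting from the lowest. With \<open>F\<close> equal to
  zero this gives uniqueness of coefficients.\<close>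

lemma powser_coeff_eq_limit:
  fixes a :: "nat \<Rightarrow> 'a::{real_normed_field,banach}"
  assumes "s > 0" "\<And>t. norm t < s \<Longrightarrow> (\<lambda>j. a j * t ^ j) sums F t"
    and lim: "(\<lambda>t. F t / t ^ m) \<midarrow>0\<rightarrow> L"
  shows "j < m \<Longrightarrow> a j = 0" "a m = L"
proof -
  show low: "a j = 0" if "j < m" for j
    using that
  proof (induction j rule: less_induct)
    case (less j)
    have "(\<lambda>t. F t / t ^ j) \<midarrow>0\<rightarrow> a j"
      using less by (intro powser_tendsto_coeff[OF assms(1,2)]) auto
    \<comment> \<open>Off the origin this is \<open>F t / t ^ j\<close>, and the extra factor with
      the positive exponent \<open>m - j\<close> forces the limit 0.\<close>
    moreover have "(\<lambda>t. F t / t ^ m * t ^ (m - j)) \<midarrow>0\<rightarrow> L * 0 ^ (m - j)"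
      by (intro tendsto_intros lim)
    then have "(\<lambda>t. F t / t ^ m * t ^ (m - j)) \<midarrow>0\<rightarrow> 0"
      using less.prems by (simp only: power_0_left) simp
    then have "(\<lambda>t. F t / t ^ j) \<midarrow>0\<rightarrow> 0"
      by (rule Lim_transform_eventually)
        (use less.prems in \<open>auto simp: eventually_at_filter power_diff\<close>)
    ultimately show ?case using tendsto_unique trivial_limit_at by blast
  qed
  show "a m = L"
    using powser_tendsto_coeff[OF assms(1,2) low] lim tendsto_unique trivial_limit_at by blast
qed

subsection \<open>Uniqueness of the expansion\<close>

lemma sum_digits_less:
  fixes \<alpha> :: "nat \<Rightarrow> nat"
  assumes "\<And>i. i < n \<Longrightarrow> \<alpha> i < B"
  shows "(\<Sum>i<n. \<alpha> i * B ^ i) < B ^ n"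
  using assms
proof (induction n)
  case (Suc n)
  have "(\<Sum>i<Suc n. \<alpha> i * B ^ i) < B ^ n + \<alpha> n * B ^ n" using Suc by simp
  also have "\<dots> = (1 + \<alpha> n) * B ^ n" by simp
  also have "\<dots> \<le> B * B ^ n" using Suc.prems[of n] by (intro mult_right_mono) auto
  finally show ?case by simp
qed simp

text \<open>This is uniqueness of digits in base \<open>B\<close>: the top digit is the quotient by
  \<open>B ^ n\<close>, and induction handles the remainder.\<close>

lemma sum_digits_inject:
  fixes \<alpha> \<beta> :: "nat \<Rightarrow> nat"
  assumes "\<And>i. i < n \<Longrightarrow> \<alpha> i < B" "\<And>i. i < n \<Longrightarrow> \<beta> i < B"
    and "(\<Sum>i<n. \<alpha> i * B ^ i) = (\<Sum>i<n. \<beta> i * B ^ i)" "i < n"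
  shows "\<alpha> i = \<beta> i"
  using assms
proof (induction n)
  case (Suc n)
  have lt: "(\<Sum>i<n. \<alpha> i * B ^ i) < B ^ n" "(\<Sum>i<n. \<beta> i * B ^ i) < B ^ n"
    using Suc.prems by (auto intro!: sum_digits_less)
  have eq: "(\<Sum>i<n. \<alpha> i * B ^ i) + \<alpha> n * B ^ n = (\<Sum>i<n. \<beta> i * B ^ i) + \<beta> n * B ^ n"
    using Suc.prems(3) by simp
  have "\<alpha> n = ((\<Sum>i<n. \<alpha> i * B ^ i) + \<alpha> n * B ^ n) div B ^ n" using lt(1) by (cases "B ^ n = 0") (auto simp: div_mult_self1)
  also have "\<dots> = \<beta> n" unfolding eq using lt(2) by (cases "B ^ n = 0") (auto simp: div_mult_self1)
  finally have top: "\<alpha> n = \<beta> n" .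
  then have rest: "(\<Sum>i<n. \<alpha> i * B ^ i) = (\<Sum>i<n. \<beta> i * B ^ i)" using eq by simp
  show ?case
  proof (cases "i = n")
    case False
    then show ?thesis using Suc.prems by (intro Suc.IH[OF _ _ rest]) auto
  qed (use top in simp)
qed simp

text \<open>Kronecker's substitution \<open>x\<^sub>i = t ^ (B ^ i)\<close> turns the monomials of degree \<open>j < B\<close> into
  distinct powers of \<open>t\<close>.\<close>

lemma hom_poly_eq_0_imp_coeff:
  assumes zero: "\<And>x. x \<in> cspace n \<Longrightarrow> hom_poly n c j x = 0"
    and \<beta>: "\<beta> \<in> multi_indices n" "mdeg n \<beta> = j"
  shows "c \<beta> = 0"
proof -
  let ?S = "{\<alpha> \<in> multi_indices n. mdeg n \<alpha> = j}"
  let ?e = "\<lambda>\<alpha> :: nat \<Rightarrow> nat. \<Sum>i<n. \<alpha> i * Suc j ^ i"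
  define p where "p = (\<Sum>\<alpha>\<in>?S. Polynomial.monom (c \<alpha>) (?e \<alpha>))"
  have "poly p t = 0" for t
  proof -
    define x where "x = (\<lambda>i. if i < n then t ^ (Suc j ^ i) else 0)"
    have "mon n \<alpha> x = t ^ ?e \<alpha>" for \<alpha>
      unfolding mon_def power_sum
      by (rule prod.cong) (simp_all add: x_def mult.commute flip: power_mult)
    then have "poly p t = hom_poly n c j x"
      by (simp add: p_def poly_sum poly_monom hom_poly_def)
    also have "\<dots> = 0" by (rule zero) (simp add: x_def cspace_def)
    finally show ?thesis .
  qed
  then have "p = 0" using poly_all_0_iff_0 by blast
  have inj: "\<alpha> = \<beta>" if "\<alpha> \<in> ?S" "?e \<alpha> = ?e \<beta>" for \<alpha>
  proof
    fix i
    have "\<alpha> i = \<beta> i" if "i < n"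
    proof (rule sum_digits_inject[where n = n and B = "Suc j" and \<alpha> = \<alpha> and \<beta> = \<beta>])
      show "\<alpha> i < Suc j" "\<beta> i < Suc j" if "i < n" for i
        \<comment> \<open>An exponent never exceeds the degree \<open>j\<close>, hence is a legal
          digit in base \<open>Suc j\<close>.\<close>
        using le_mdeg[OF that, of \<alpha>] le_mdeg[OF that, of \<beta>] \<open>\<alpha> \<in> ?S\<close> \<beta> by auto
    qed (use \<open>?e \<alpha> = ?e \<beta>\<close> that in auto)
    then show "\<alpha> i = \<beta> i" using \<open>\<alpha> \<in> ?S\<close> \<beta> by (cases "i < n") (auto simp: multi_indices_def)
  qed
  have "Polynomial.coeff p (?e \<beta>) = (\<Sum>\<alpha>\<in>?S. if \<alpha> = \<beta> then c \<alpha> else 0)"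
    unfolding p_def coeff_sum by (rule sum.cong) (use inj in \<open>auto simp: coeff_monom\<close>)
  also have "\<dots> = c \<beta>" using \<beta> by (simp add: finite_mdeg_eq)
  finally show ?thesis using \<open>p = 0\<close> by simp
qed

text \<open>Along each ray the difference of the two series sums to zero, so all homogeneous parts
  of \<open>c - d\<close> vanish as functions, and Kronecker's substitution then kills each
  coefficient.\<close>

lemma has_expansion_unique:
  assumes c: "has_expansion n f c" and d: "has_expansion n f d"
  shows "c = d"
proof
  fix \<alpha>
  show "c \<alpha> = d \<alpha>"
  proof (cases "\<alpha> \<in> multi_indices n")
    case True
    have "hom_poly n (\<lambda>\<alpha>. c \<alpha> - d \<alpha>) j x = 0" if x: "x \<in> cspace n" for j x
    proof -
      obtain s where s: "s > 0" "\<And>t. norm t < s \<Longrightarrow> (\<lambda>j. hom_poly n c j x * t ^ j) sums f (\<lambda>i. t * x i)"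
        using sums_along_ray[OF c x] by blast
      obtain s' where s': "s' > 0" "\<And>t. norm t < s' \<Longrightarrow> (\<lambda>j. hom_poly n d j x * t ^ j) sums f (\<lambda>i. t * x i)"
        using sums_along_ray[OF d x] by blast
      have diff: "(\<lambda>j. hom_poly n (\<lambda>\<alpha>. c \<alpha> - d \<alpha>) j x * t ^ j) sums 0" if "norm t < min s s'" for t
        using sums_diff[OF s(2) s'(2), of t t] that by (simp add: hom_poly_diff left_diff_distrib)
      show ?thesis
        by (rule powser_coeff_eq_limit(2)[where s = "min s s'", OF _ diff]) (use s(1) s'(1) in simp_all)
    qed
    then have "c \<alpha> - d \<alpha> = 0"
      using hom_poly_eq_0_imp_coeff[where c = "\<lambda>\<alpha>. c \<alpha> - d \<alpha>"] True by blast
    then show ?thesis by simp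
  next
    case False
    then have "c \<alpha> = 0" "d \<alpha> = 0" using has_expansion_outside[OF c] has_expansion_outside[OF d] by blast+
    then show ?thesis by simp
  qed
qed

lemma taylor_eq: "has_expansion n f c \<Longrightarrow> taylor n f = c"
  unfolding taylor_def using has_expansion_unique by blast

lemma hom_part_eq: "has_expansion n f c \<Longrightarrow> hom_part n f = hom_poly n c"
  by (intro ext) (simp add: hom_part_def hom_poly_def taylor_eq)

subsection \<open>The initial form as a limit along rays\<close>

text \<open>Existence of the limits forces all parts of degree below \<open>m\<close> to vanish, and
  \<open>x0\<close> shows that the part of degree \<open>m\<close> survives. Initial forms can thus
  be found without computing Taylor coefficients.\<close>

lemma initial_form_eqI:
  assumes c: "has_expansion n f c"
    and lim: "\<And>x. x \<in> cspace n \<Longrightarrow> (\<lambda>t. f (\<lambda>i. t * x i) / t ^ m) \<midarrow>0\<rightarrow> P x"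
    and x0: "x0 \<in> cspace n" "P x0 \<noteq> 0"
  shows "ord0 n f = m" "x \<in> cspace n \<Longrightarrow> initial_form n f x = P x"
proof -
  have coeffs: "(\<forall>j<m. hom_part n f j x = 0) \<and> hom_part n f m x = P x" if x: "x \<in> cspace n" for x
  proof -
    obtain s where s: "s > 0" "\<And>t. norm t < s \<Longrightarrow> (\<lambda>j. hom_poly n c j x * t ^ j) sums f (\<lambda>i. t * x i)"
      using sums_along_ray[OF c x] by blast
    from powser_coeff_eq_limit[OF this lim[OF x]] show ?thesis
      unfolding hom_part_eq[OF c] by blast
  qed
  show ord: "ord0 n f = m"
    unfolding ord0_def
  proof (rule Least_equality)
    show "\<exists>x\<in>cspace n. hom_part n f m x \<noteq> 0" 
      by (rule bexI[of _ x0]) (use coeffs[OF x0(1)] x0 in simp_all)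
    show "m \<le> j" if "\<exists>x\<in>cspace n. hom_part n f j x \<noteq> 0" for j
      using coeffs that not_le_imp_less by blast
  qed
  show "initial_form n f x = P x" if "x \<in> cspace n"
    using coeffs[OF that] by (simp add: initial_form_def ord)
qed

text \<open>A germ vanishing near the origin vanishes along a short piece of every ray, which would
  make the limit 0.\<close>

lemma nonzero_germ_limit:
  assumes lim: "(\<lambda>t. f (\<lambda>i. t * x i) / t ^ m) \<midarrow>0\<rightarrow> L"
    and "x \<in> cspace n" "L \<noteq> 0"
  shows "nonzero_germ n f"
  unfolding nonzero_germ_def
proof
  assume "\<exists>U. nbhd0 n U \<and> (\<forall>x\<in>U. f x = 0)"
  then obtain U where U: "openin (top_of_set (cspace n)) U" "origin \<in> U" "\<And>x. x \<in> U \<Longrightarrow> f x = 0"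
    by (auto simp: nbhd0_def)
  obtain T where T: "open T" "U = cspace n \<inter> T" using U(1) by (auto simp: openin_open)
  have "continuous_on UNIV (\<lambda>(t :: complex) i :: nat. t * x i)"
    by (rule continuous_on_coordinatewise_then_product) (rule continuous_on_mult_right, rule continuous_on_id)
  then have "open ((\<lambda>t i. t * x i) -` T)" using T(1) open_vimage by blast
  moreover have "0 \<in> (\<lambda>t i. t * x i) -` T" using U(2) T(2) by auto
  ultimately have "\<forall>\<^sub>F t in nhds 0. t \<in> (\<lambda>t i. t * x i) -` T"
    by (rule eventually_nhds_in_open)
  then have "\<forall>\<^sub>F t in at 0. (\<lambda>i. t * x i) \<in> T"
    by (simp add: eventually_nhds_conv_at)
  then have "\<forall>\<^sub>F t in at 0. f (\<lambda>i. t * x i) / t ^ m = 0"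
    by (rule eventually_mono) (use U(3) T(2) assms(2) in \<open>simp add: cspace_scale\<close>)
  then have "(\<lambda>t. f (\<lambda>i. t * x i) / t ^ m) \<midarrow>0\<rightarrow> 0"
    by (simp add: tendsto_eventually)
  with lim \<open>L \<noteq> 0\<close> show False using tendsto_unique trivial_limit_at by blast
qed

lemma nbhd0_polydisc:
  assumes "r > 0"
  shows "nbhd0 n (polydisc n r)"
proof -
  have "open (\<Inter>i\<in>{..<n}. (\<lambda>x :: nat \<Rightarrow> complex. x i) -` ball 0 r)"
    by (intro open_INT ballI open_vimage open_ball continuous_on_product_coordinates) auto
  moreover have "polydisc n r = cspace n \<inter> (\<Inter>i\<in>{..<n}. (\<lambda>x. x i) -` ball 0 r)"
    by (auto simp: polydisc_def)
  ultimately have "openin (top_of_set (cspace n)) (polydisc n r)" by (metis openin_open_Int)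
  then show ?thesis using assms by (simp add: nbhd0_def polydisc_def cspace_def)
qed

lemma initial_form_holo_germ:
  assumes "holo_germ n f" "nonzero_germ n f"
  shows "\<exists>x\<in>cspace n. initial_form n f x \<noteq> 0"
    and "ord0 n f > 0"
    and "x \<in> cspace n \<Longrightarrow> (\<lambda>t. f (\<lambda>i. t * x i) / t ^ ord0 n f) \<midarrow>0\<rightarrow> initial_form n f x"
    and "initial_form n f (\<lambda>i. t * x i) = initial_form n f x * t ^ ord0 n f"
    and "continuous_on S (initial_form n f)"
proof -
  obtain c where c: "has_expansion n f c" and f0: "f origin = 0"
    using assms(1) by (auto simp: holo_germ_def)
  \<comment> \<open>This guarantees that the \<open>LEAST\<close> in \<open>ord0\<close> is
    attained: if all homogeneous parts vanished, so would \<open>f\<close> on a polydisc.\<close>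
  have "\<exists>m. \<exists>x\<in>cspace n. hom_part n f m x \<noteq> 0"
  proof (rule ccontr)
    assume "\<not> ?thesis"
    then have 0: "hom_poly n c m x = 0" if "x \<in> cspace n" for m x
      using that hom_part_eq[OF c] by metis
    obtain r where r: "r > 0"
      "\<And>x. x \<in> polydisc n r \<Longrightarrow> ((\<lambda>\<alpha>. c \<alpha> * mon n \<alpha> x) has_sum f x) (multi_indices n)"
      using has_expansionD[OF c] by blast
    have "f x = 0" if "x \<in> polydisc n r" for x
    proof -
      have "(\<lambda>j. hom_poly n c j x) sums f x" using sums_hom_poly[OF r(2)[OF that]] .
      moreover have "hom_poly n c j x = 0" for j using 0 that by (simp add: polydisc_def)
      ultimately show ?thesis using sums_unique2[OF sums_zero] by simp
    qed
    then show False using assms(2) nbhd0_polydisc[OF r(1)] unfolding nonzero_germ_def by blast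
  qed
  then show 1: "\<exists>x\<in>cspace n. initial_form n f x \<noteq> 0"
    unfolding initial_form_def ord0_def by (rule LeastI_ex)
  have low: "hom_part n f j x = 0" if "x \<in> cspace n" "j < ord0 n f" for x j
    using that not_less_Least[OF that(2)[unfolded ord0_def]] by blast
  show "(\<lambda>t. f (\<lambda>i. t * x i) / t ^ ord0 n f) \<midarrow>0\<rightarrow> initial_form n f x"
    if x: "x \<in> cspace n" for x
  proof -
    obtain s where "s > 0" "\<And>t. norm t < s \<Longrightarrow> (\<lambda>j. hom_poly n c j x * t ^ j) sums f (\<lambda>i. t * x i)"
      using sums_along_ray[OF c x] by blast
    from powser_tendsto_coeff[OF this] show ?thesis
      using low[OF x] by (simp add: initial_form_def hom_part_eq[OF c])
  qed
  show "initial_form n f (\<lambda>i. t * x i) = initial_form n f x * t ^ ord0 n f" for t x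
    by (simp add: initial_form_def hom_part_eq[OF c] hom_poly_scale)
  show "continuous_on S (initial_form n f)"
    by (simp add: initial_form_def hom_part_eq[OF c] continuous_on_hom_poly)
  \<comment> \<open>The ray series at \<open>t = 0\<close> reduces to its constant term, which is
    therefore \<open>f origin = 0\<close>.\<close>
  show "ord0 n f > 0"
  proof (rule ccontr)
    assume "\<not> ?thesis"
    then have 0: "ord0 n f = 0" by simp
    obtain x where x: "x \<in> cspace n" "initial_form n f x \<noteq> 0" using 1 by blast
    obtain s where "s > 0" "\<And>t. norm t < s \<Longrightarrow> (\<lambda>j. hom_poly n c j x * t ^ j) sums f (\<lambda>i. t * x i)"
      using sums_along_ray[OF c x(1)] by blast
    from this(2)[of 0] this(1) have "hom_poly n c 0 x = 0" using f0 by simp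
    then show False using x(2) 0 by (simp add: initial_form_def hom_part_eq[OF c])
  qed
qed

subsection \<open>Sums, products and pullbacks of expansions\<close>

lemma polydisc_mono: "r \<le> r' \<Longrightarrow> polydisc n r \<subseteq> polydisc n r'"
  by (auto simp: polydisc_def)

lemma has_expansionD2:
  assumes "has_expansion n f c" "has_expansion n g d"
  obtains r where "r > 0"
    "\<And>x. x \<in> polydisc n r \<Longrightarrow> ((\<lambda>\<alpha>. c \<alpha> * mon n \<alpha> x) has_sum f x) (multi_indices n)"
    "\<And>x. x \<in> polydisc n r \<Longrightarrow> ((\<lambda>\<alpha>. d \<alpha> * mon n \<alpha> x) has_sum g x) (multi_indices n)"
proof -
  obtain r where r: "r > 0"
    "\<And>x. x \<in> polydisc n r \<Longrightarrow> ((\<lambda>\<alpha>. c \<alpha> * mon n \<alpha> x) has_sum f x) (multi_indices n)"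
    using has_expansionD[OF assms(1)] by blast
  obtain r' where r': "r' > 0"
    "\<And>x. x \<in> polydisc n r' \<Longrightarrow> ((\<lambda>\<alpha>. d \<alpha> * mon n \<alpha> x) has_sum g x) (multi_indices n)"
    using has_expansionD[OF assms(2)] by blast
  show thesis
    using that[of "min r r'"] r r' polydisc_mono[of "min r r'" r n] polydisc_mono[of "min r r'" r' n]
    by auto
qed

lemma has_expansion_add:
  assumes "has_expansion n f c" "has_expansion n g d"
  shows "has_expansion n (\<lambda>x. f x + g x) (\<lambda>\<alpha>. c \<alpha> + d \<alpha>)"
proof -
  obtain r where r: "r > 0"
    "\<And>x. x \<in> polydisc n r \<Longrightarrow> ((\<lambda>\<alpha>. c \<alpha> * mon n \<alpha> x) has_sum f x) (multi_indices n)"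
    "\<And>x. x \<in> polydisc n r \<Longrightarrow> ((\<lambda>\<alpha>. d \<alpha> * mon n \<alpha> x) has_sum g x) (multi_indices n)"
    using has_expansionD2[OF assms] by blast
  show ?thesis
  proof (rule has_expansionI[OF r(1)])
    show "((\<lambda>\<alpha>. (c \<alpha> + d \<alpha>) * mon n \<alpha> x) has_sum f x + g x) (multi_indices n)"
      if "x \<in> polydisc n r" for x
      using has_sum_add[OF r(2)[OF that] r(3)[OF that]] by (simp add: distrib_right)
  qed (simp add: has_expansion_outside[OF assms(1)] has_expansion_outside[OF assms(2)])
qed

text \<open>Summable complex families are absolutely summable, so the product family is absolutely
  summable on \<open>A \<times> B\<close> and may be summed iteratively.\<close>

lemma has_sum_product_complex:
  fixes u :: "'a \<Rightarrow> complex" and v :: "'b \<Rightarrow> complex"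
  assumes u: "(u has_sum a) A" and v: "(v has_sum b) B"
  shows "((\<lambda>(x, y). u x * v y) has_sum a * b) (A \<times> B)"
proof (rule has_sum_SigmaI[where g = "\<lambda>x. u x * b"])
  show "((\<lambda>y. (case (x, y) of (x, y) \<Rightarrow> u x * v y)) has_sum u x * b) B" for x
    using has_sum_cmult_right[OF v] by simp
  show "((\<lambda>x. u x * b) has_sum a * b) A"
    by (rule has_sum_cmult_left[OF u])
  have u': "(\<lambda>x. norm (u x)) summable_on A" and v': "(\<lambda>y. norm (v y)) summable_on B"
    using u v summable_on_iff_abs_summable_on_complex has_sum_imp_summable by blast+
  have "(\<lambda>p. norm (case p of (x, y) \<Rightarrow> u x * v y)) summable_on A \<times> B"
  proof (rule Infinite_Sum.abs_summable_on_Sigma_iff[THEN iffD2], intro conjI ballI)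
    show "(\<lambda>y. norm (case (x, y) of (x, y) \<Rightarrow> u x * v y)) summable_on B" for x
      using summable_on_cmult_right[OF v'] by (simp add: norm_mult)
    show "(\<lambda>x. norm (\<Sum>\<^sub>\<infinity>y\<in>B. norm (case (x, y) of (x, y) \<Rightarrow> u x * v y))) summable_on A"
      using summable_on_cmult_left[OF u', of "\<Sum>\<^sub>\<infinity>y\<in>B. norm (v y)"]
      by (simp add: norm_mult infsum_cmult_right' abs_mult infsum_nonneg)
  qed
  then show "(\<lambda>(x, y). u x * v y) summable_on A \<times> B"
    by (rule abs_summable_summable)
qed

lemma mon_add: "mon n (\<lambda>i. \<alpha> i + \<beta> i) x = mon n \<alpha> x * mon n \<beta> x"
  by (simp add: mon_def power_add prod.distrib)

lemma mdeg_add: "mdeg n (\<lambda>i. \<alpha> i + \<beta> i) = mdeg n \<alpha> + mdeg n \<beta>"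
  by (simp add: mdeg_def sum.distrib)

text \<open>This is the Cauchy product: the double series over pairs
  \<open>(\<alpha>, \<beta>)\<close> is regrouped according to the sum of the two
  multi-indices.\<close>

lemma has_expansion_mult:
  assumes "has_expansion n f c" "has_expansion n g d"
  shows "has_expansion n (\<lambda>x. f x * g x) (c \<otimes>\<^bsub>conv_series n\<^esub> d)"
proof -
  let ?M = "multi_indices n"
  define S where "S \<gamma> = {(\<alpha>, \<beta>). \<alpha> \<in> ?M \<and> \<beta> \<in> ?M \<and> (\<forall>i. \<alpha> i + \<beta> i = \<gamma> i)}" for \<gamma> :: "nat \<Rightarrow> nat"
  have cd: "(c \<otimes>\<^bsub>conv_series n\<^esub> d) \<gamma> = (\<Sum>(\<alpha>, \<beta>)\<in>S \<gamma>. c \<alpha> * d \<beta>)" for \<gamma>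
    by (simp add: conv_series_def S_def)
  have S_eq: "\<gamma> = (\<lambda>i. \<alpha> i + \<beta> i)" if "(\<alpha>, \<beta>) \<in> S \<gamma>" for \<alpha> \<beta> \<gamma>
    using that by (auto simp: S_def)
  \<comment> \<open>Degrees add, so both members of a pair have degree at most that of
    \<open>\<gamma>\<close>.\<close>
  have fin: "finite (S \<gamma>)" for \<gamma>
  proof (rule finite_subset)
    let ?D = "\<Union>j\<le>mdeg n \<gamma>. {\<alpha> \<in> ?M. mdeg n \<alpha> = j}"
    show "S \<gamma> \<subseteq> ?D \<times> ?D"
    proof safe
      fix \<alpha> \<beta> assume ab: "(\<alpha>, \<beta>) \<in> S \<gamma>"
      then have "mdeg n \<gamma> = mdeg n \<alpha> + mdeg n \<beta>" using S_eq mdeg_add by metis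
      with ab show "\<alpha> \<in> ?D" "\<beta> \<in> ?D" by (auto simp: S_def)
    qed
    show "finite (?D \<times> ?D)" by (intro finite_cartesian_product finite_UN_I finite_mdeg_eq) auto
  qed
  obtain r where r: "r > 0"
    "\<And>x. x \<in> polydisc n r \<Longrightarrow> ((\<lambda>\<alpha>. c \<alpha> * mon n \<alpha> x) has_sum f x) ?M"
    "\<And>x. x \<in> polydisc n r \<Longrightarrow> ((\<lambda>\<alpha>. d \<alpha> * mon n \<alpha> x) has_sum g x) ?M"
    using has_expansionD2[OF assms] by blast
  show ?thesis
  proof (rule has_expansionI[OF r(1)])
    fix x assume x: "x \<in> polydisc n r"
    let ?p = "\<lambda>(\<alpha>, \<beta>). c \<alpha> * mon n \<alpha> x * (d \<beta> * mon n \<beta> x)"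
    have "(?p has_sum f x * g x) (?M \<times> ?M)"
      by (rule has_sum_product_complex[OF r(2)[OF x] r(3)[OF x]])
    also have "?this \<longleftrightarrow> ((\<lambda>(\<gamma>, q). ?p q) has_sum f x * g x) (Sigma ?M S)"
      by (rule has_sum_reindex_bij_witness[where i = snd and j = "\<lambda>(\<alpha>, \<beta>). (\<lambda>i. \<alpha> i + \<beta> i, \<alpha>, \<beta>)"])
        (auto simp: S_def multi_indices_def)
    finally have "((\<lambda>\<gamma>. \<Sum>q\<in>S \<gamma>. ?p q) has_sum f x * g x) ?M"
      by (rule has_sum_SigmaD) (auto intro: has_sum_finite fin)
    moreover have "(\<Sum>q\<in>S \<gamma>. ?p q) = (c \<otimes>\<^bsub>conv_series n\<^esub> d) \<gamma> * mon n \<gamma> x" for \<gamma>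
      unfolding cd sum_distrib_right
      by (rule sum.cong) (auto simp: mon_add dest!: S_eq)
    ultimately show "((\<lambda>\<gamma>. (c \<otimes>\<^bsub>conv_series n\<^esub> d) \<gamma> * mon n \<gamma> x) has_sum f x * g x) ?M"
      by simp
  next
    fix \<gamma> assume "\<gamma> \<notin> ?M"
    have "\<gamma> \<in> ?M" if "(\<alpha>, \<beta>) \<in> S \<gamma>" for \<alpha> \<beta>
      using S_eq[OF that] that by (auto simp: S_def multi_indices_def)
    with \<open>\<gamma> \<notin> ?M\<close> have "S \<gamma> = {}" by auto
    then show "(c \<otimes>\<^bsub>conv_series n\<^esub> d) \<gamma> = 0" by (simp add: cd)
  qed
qed

lemma has_expansion_mon:
  assumes "\<beta> \<in> multi_indices n"
  shows "has_expansion n (mon n \<beta>) (\<lambda>\<alpha>. if \<alpha> = \<beta> then 1 else 0)"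
proof (rule has_expansionI[of 1])
  show "((\<lambda>\<alpha>. (if \<alpha> = \<beta> then 1 else 0) * mon n \<alpha> x) has_sum mon n \<beta> x) (multi_indices n)" for x
    by (rule has_sum_finite_neutralI[where B = "{\<beta>}"]) (use assms in auto)
qed (use assms in auto)

section \<open>Pullback along the projection to the first coordinates\<close>

definition trunc :: "nat \<Rightarrow> (nat \<Rightarrow> complex) \<Rightarrow> nat \<Rightarrow> complex" where
  "trunc n z = (\<lambda>i. if i < n then z i else 0)"

lemma trunc_in_cspace: "trunc n z \<in> cspace n"
  by (simp add: trunc_def cspace_def)

lemma trunc_id: "x \<in> cspace n \<Longrightarrow> trunc n x = x"
  by (auto simp: trunc_def cspace_def)

lemma trunc_scale: "trunc n (\<lambda>i. t * z i) = (\<lambda>i. t * trunc n z i)"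
  by (auto simp: trunc_def)

lemma continuous_on_trunc: "continuous_on S (trunc n)"
  unfolding trunc_def[abs_def]
proof (rule continuous_on_coordinatewise_then_product)
  have "continuous_on S (\<lambda>z. z i)" for i
    by (rule continuous_on_subset[OF continuous_on_product_coordinates]) simp
  then show "continuous_on S (\<lambda>z. if i < n then z i else 0)" for i
    by (cases "i < n") simp_all
qed

lemma cspace_mono: "n \<le> N \<Longrightarrow> cspace n \<subseteq> cspace N"
  by (auto simp: cspace_def)

text \<open>The same coefficient family serves in \<open>N\<close> variables: it vanishes outside
  \<open>multi_indices n\<close>, and the remaining monomials do not involve the new
  variables.\<close>

lemma has_expansion_trunc:
  assumes c: "has_expansion n f c" and "n \<le> N"
  shows "has_expansion N (\<lambda>z. f (trunc n z)) c"
proof -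
  obtain r where r: "r > 0"
    "\<And>x. x \<in> polydisc n r \<Longrightarrow> ((\<lambda>\<alpha>. c \<alpha> * mon n \<alpha> x) has_sum f x) (multi_indices n)"
    using has_expansionD[OF c] by blast
  have sub: "multi_indices n \<subseteq> multi_indices N" using \<open>n \<le> N\<close> by (auto simp: multi_indices_def)
  have mon: "mon N \<alpha> z = mon n \<alpha> (trunc n z)" if "\<alpha> \<in> multi_indices n" for \<alpha> z
  proof -
    have "mon N \<alpha> z = (\<Prod>i<n. z i ^ \<alpha> i)"
      unfolding mon_def by (rule prod.mono_neutral_right) (use that \<open>n \<le> N\<close> in \<open>auto simp: multi_indices_def\<close>)
    also have "\<dots> = mon n \<alpha> (trunc n z)" by (simp add: mon_def trunc_def)
    finally show ?thesis .
  qed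
  show ?thesis
  proof (rule has_expansionI[OF r(1)])
    fix z assume "z \<in> polydisc N r"
    then have "trunc n z \<in> polydisc n r" using \<open>n \<le> N\<close> by (auto simp: polydisc_def trunc_def cspace_def)
    then have "((\<lambda>\<alpha>. c \<alpha> * mon n \<alpha> (trunc n z)) has_sum f (trunc n z)) (multi_indices n)" by (rule r(2))
    then show "((\<lambda>\<alpha>. c \<alpha> * mon N \<alpha> z) has_sum f (trunc n z)) (multi_indices N)"
      by (rule has_sum_cong_neutral[THEN iffD1, rotated -1])
        (use sub has_expansion_outside[OF c] in \<open>auto simp: mon\<close>)
  qed (use sub has_expansion_outside[OF c] in blast)
qed

subsection \<open>Stabilisation\<close>

text \<open>The coordinates of index \<open>n\<close> and \<open>Suc n\<close> play the roles of
  \<open>s\<close> and \<open>t\<close> in the overview. The square makes room for an integer degree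
  strictly between the two doubled orders, and also lets the fibre of the initial form split by
  sign.\<close>

definition stab :: "nat \<Rightarrow> nat \<Rightarrow> ((nat \<Rightarrow> complex) \<Rightarrow> complex) \<Rightarrow> (nat \<Rightarrow> complex) \<Rightarrow> complex" where
  "stab n k f z = f (trunc n z) ^ 2 + z n ^ k * z (Suc n)"

lemma holo_germ_stab:
  assumes "holo_germ n f"
  shows "holo_germ (Suc (Suc n)) (stab n k f)"
proof -
  obtain c where c: "has_expansion n f c" and f0: "f origin = 0"
    using assms by (auto simp: holo_germ_def)
  define \<beta> where "\<beta> = (\<lambda>i. if i = n then k else if i = Suc n then 1 else 0)"
  have "\<beta> \<in> multi_indices (Suc (Suc n))" by (auto simp: \<beta>_def multi_indices_def)
  note h = has_expansion_mon[OF this]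
  have "has_expansion (Suc (Suc n)) (\<lambda>z. f (trunc n z)) c"
    using c by (rule has_expansion_trunc) simp
  note has_expansion_add[OF has_expansion_mult[OF this this] h]
  moreover have "mon (Suc (Suc n)) \<beta> z = z n ^ k * z (Suc n)" for z
    by (simp add: mon_def \<beta>_def)
  ultimately have "\<exists>d. has_expansion (Suc (Suc n)) (stab n k f) d"
    unfolding stab_def[abs_def] power2_eq_square by (auto intro!: exI)
  moreover have "trunc n origin = origin" by (simp add: trunc_def)
  ultimately show ?thesis using f0 by (simp add: holo_germ_def stab_def)
qed

section \<open>Topological equivalence under symmetry and stabilisation\<close>

lemma top_right_equiv_sym:
  assumes "top_right_equiv n f g"
  shows "top_right_equiv n g f"
proof -
  obtain U V \<phi> \<psi> where *: "nbhd0 n U" "nbhd0 n V" "homeomorphism U V \<phi> \<psi>" "\<phi> origin = origin"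
    "\<And>x. x \<in> U \<Longrightarrow> f x = g (\<phi> x)"
    using assms unfolding top_right_equiv_def by blast
  have "origin \<in> U" using * by (simp add: nbhd0_def)
  then have "\<psi> origin = origin" using *(3,4) homeomorphism_apply1 by metis
  moreover have "g y = f (\<psi> y)" if "y \<in> V" for y
  proof -
    have "\<psi> y \<in> U" "\<phi> (\<psi> y) = y" using *(3) that by (auto simp: homeomorphism_def)
    then show ?thesis using *(5) by metis
  qed
  moreover have "homeomorphism V U \<psi> \<phi>" using *(3) by (rule homeomorphism_symD)
  ultimately show ?thesis using *(1,2) unfolding top_right_equiv_def by blast
qed

lemma nbhd0_trunc:
  assumes "nbhd0 n U"
  shows "nbhd0 N {z \<in> cspace N. trunc n z \<in> U}"
proof -
  obtain T where T: "open T" "U = cspace n \<inter> T"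
    using assms by (auto simp: nbhd0_def openin_open)
  have "{z \<in> cspace N. trunc n z \<in> U} = cspace N \<inter> trunc n -` T"
    using T(2) trunc_in_cspace by auto
  moreover have "open (trunc n -` T)" using T(1) continuous_on_trunc open_vimage by blast
  ultimately have "openin (top_of_set (cspace N)) {z \<in> cspace N. trunc n z \<in> U}"
    by (simp add: openin_open_Int)
  then show ?thesis using assms by (simp add: nbhd0_def cspace_def trunc_def)
qed

text \<open>The germ of homeomorphism is extended by the identity on the new coordinates.\<close>

lemma top_right_equiv_stab:
  assumes "top_right_equiv n f g"
  shows "top_right_equiv (Suc (Suc n)) (stab n k f) (stab n k g)"
proof -
  let ?N = "Suc (Suc n)"
  obtain U V \<phi> \<psi> where *: "nbhd0 n U" "nbhd0 n V" "homeomorphism U V \<phi> \<psi>" "\<phi> origin = origin"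
    "\<And>x. x \<in> U \<Longrightarrow> f x = g (\<phi> x)"
    using assms unfolding top_right_equiv_def by blast
  define ext where "ext \<theta> z = (\<lambda>i. if i < n then \<theta> (trunc n z) i else z i)"
    for \<theta> :: "(nat \<Rightarrow> complex) \<Rightarrow> nat \<Rightarrow> complex" and z
  let ?L = "\<lambda>U. {z \<in> cspace ?N. trunc n z \<in> U}"
  have sub: "U \<subseteq> cspace n" "V \<subseteq> cspace n"
    using *(1,2) by (auto simp: nbhd0_def dest: openin_imp_subset)
  \<comment> \<open>\<open>ext\<close> discards all coordinates of a value of
    \<open>\<theta>\<close> from index \<open>n\<close> on; membership in \<open>cspace n\<close>
    ensures that nothing is lost.\<close>
  have trunc_ext: "trunc n (ext \<theta> z) = \<theta> (trunc n z)" if "\<theta> (trunc n z) \<in> cspace n" for \<theta> z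
    using that by (auto simp: trunc_def ext_def cspace_def)
  have ext_ext: "ext \<theta>' (ext \<theta> z) = z"
    if "\<theta> (trunc n z) \<in> cspace n" "\<theta>' (\<theta> (trunc n z)) = trunc n z" for \<theta> \<theta>' z
  proof
    show "ext \<theta>' (ext \<theta> z) i = z i" for i
      using trunc_ext[where \<theta> = \<theta>, OF that(1)] that(2) by (simp add: ext_def[of \<theta>']) (simp add: ext_def trunc_def)
  qed
  have ext_in: "ext \<theta> z \<in> ?L W" if "z \<in> cspace ?N" "\<theta> (trunc n z) \<in> W" "W \<subseteq> cspace n" for \<theta> z W
  proof -
    have "trunc n (ext \<theta> z) \<in> W" using trunc_ext that by (metis subsetD)
    moreover have "ext \<theta> z \<in> cspace ?N" using that(1) by (simp add: ext_def cspace_def)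
    ultimately show ?thesis by simp
  qed
  have cont: "continuous_on (?L W) (ext \<theta>)" if \<theta>: "continuous_on W \<theta>" for W \<theta>
    unfolding ext_def[abs_def]
  proof (rule continuous_on_coordinatewise_then_product)
    fix i
    have "continuous_on (?L W) (\<lambda>z. \<theta> (trunc n z))"
      by (rule continuous_on_compose2[OF \<theta> continuous_on_trunc]) auto
    then have "continuous_on (?L W) (\<lambda>z. \<theta> (trunc n z) i)"
      by (rule continuous_on_product_then_coordinatewise)
    moreover have "continuous_on (?L W) (\<lambda>z. z i)"
      by (rule continuous_on_subset[OF continuous_on_product_coordinates]) simp
    ultimately show "continuous_on (?L W) (\<lambda>z. if i < n then \<theta> (trunc n z) i else z i)"
      by (cases "i < n") simp_all
  qed
  have hU: "\<phi> x \<in> V" "\<psi> (\<phi> x) = x" if "x \<in> U" for x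
    using *(3) that by (auto simp: homeomorphism_def)
  have hV: "\<psi> y \<in> U" "\<phi> (\<psi> y) = y" if "y \<in> V" for y
    using *(3) that by (auto simp: homeomorphism_def)
  have "homeomorphism (?L U) (?L V) (ext \<phi>) (ext \<psi>)"
  proof (rule homeomorphismI)
    show "continuous_on (?L U) (ext \<phi>)" "continuous_on (?L V) (ext \<psi>)"
      using *(3) by (auto intro!: cont simp: homeomorphism_def)
    show "ext \<phi> ` ?L U \<subseteq> ?L V" using ext_in hU(1) sub(2) by blast
    show "ext \<psi> ` ?L V \<subseteq> ?L U" using ext_in hV(1) sub(1) by blast
    show "ext \<psi> (ext \<phi> z) = z" if "z \<in> ?L U" for z
      using that hU sub by (intro ext_ext) auto
    show "ext \<phi> (ext \<psi> z) = z" if "z \<in> ?L V" for z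
      using that hV sub by (intro ext_ext) auto
  qed
  moreover have "ext \<phi> origin = origin"
    using *(4) by (auto simp: ext_def trunc_id[of origin] cspace_def)
  moreover have "stab n k f z = stab n k g (ext \<phi> z)" if "z \<in> ?L U" for z
  proof -
    have "trunc n (ext \<phi> z) = \<phi> (trunc n z)" using that hU(1) sub(2) by (intro trunc_ext) auto
    then show ?thesis using that *(5) by (simp add: stab_def) (simp add: ext_def)
  qed
  ultimately show ?thesis
    using nbhd0_trunc[OF *(1)] nbhd0_trunc[OF *(2)] unfolding top_right_equiv_def by blast
qed

section \<open>Initial forms of the stabilised germs\<close>

lemma stab_along_ray:
  "stab n k f (\<lambda>i. t * z i) = f (\<lambda>i. t * trunc n z i) ^ 2 + t ^ Suc k * (z n ^ k * z (Suc n))"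
  by (simp add: stab_def trunc_scale power_mult_distrib)

text \<open>After division by \<open>t ^ (2 * ord0 n f)\<close> the monomial still carries a
  positive power of \<open>t\<close>, so only the square of the initial form of \<open>f\<close>
  remains in the limit.\<close>

lemma stab_low_order:
  assumes f: "holo_germ n f" "nonzero_germ n f" and k: "2 * ord0 n f < Suc k"
  shows "nonzero_germ (Suc (Suc n)) (stab n k f)"
    and "initial_fibre (Suc (Suc n)) (stab n k f) =
      {z \<in> cspace (Suc (Suc n)). initial_form n f (trunc n z) ^ 2 = 1}"
proof -
  let ?N = "Suc (Suc n)" and ?m = "ord0 n f"
  note lim_f = initial_form_holo_germ(3)[OF f trunc_in_cspace]
  have lim: "(\<lambda>t. stab n k f (\<lambda>i. t * z i) / t ^ (2 * ?m)) \<midarrow>0\<rightarrow> initial_form n f (trunc n z) ^ 2" for z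
  proof (rule Lim_transform_eventually)
    show "(\<lambda>t. (f (\<lambda>i. t * trunc n z i) / t ^ ?m) ^ 2 + t ^ (Suc k - 2 * ?m) * (z n ^ k * z (Suc n)))
        \<midarrow>0\<rightarrow> initial_form n f (trunc n z) ^ 2"
      using tendsto_add[OF tendsto_power[OF lim_f]
          tendsto_mult_left_zero[OF tendsto_null_power[OF tendsto_ident_at]]] k by simp
    show "\<forall>\<^sub>F t in at 0. (f (\<lambda>i. t * trunc n z i) / t ^ ?m) ^ 2
        + t ^ (Suc k - 2 * ?m) * (z n ^ k * z (Suc n)) = stab n k f (\<lambda>i. t * z i) / t ^ (2 * ?m)"
      unfolding eventually_at_filter stab_along_ray
      using k by (intro always_eventually)
        (auto simp: power_diff power_divide add_divide_distrib mult.commute simp flip: power_mult)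
  qed
  obtain x where "x \<in> cspace n" "initial_form n f x \<noteq> 0"
    using initial_form_holo_germ(1)[OF f] by blast
  then have x: "x \<in> cspace ?N" "initial_form n f (trunc n x) ^ 2 \<noteq> 0"
    using cspace_mono[of n ?N] by (auto simp: trunc_id)
  show "nonzero_germ ?N (stab n k f)"
    using nonzero_germ_limit[OF lim x] .
  obtain c where c: "has_expansion ?N (stab n k f) c"
    using holo_germ_stab[OF f(1)] by (auto simp: holo_germ_def)
  show "initial_fibre ?N (stab n k f) = {z \<in> cspace ?N. initial_form n f (trunc n z) ^ 2 = 1}"
    using initial_form_eqI(2)[OF c lim x] by (auto simp: initial_fibre_def)
qed

text \<open>Here division by \<open>t ^ Suc k\<close> leaves the monomial unchanged, while the
  square keeps a positive power of \<open>t\<close> and disappears in the limit.\<close>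

lemma stab_high_order:
  assumes f: "holo_germ n f" "nonzero_germ n f" and k: "Suc k < 2 * ord0 n f"
  shows "nonzero_germ (Suc (Suc n)) (stab n k f)"
    and "initial_fibre (Suc (Suc n)) (stab n k f) =
      {z \<in> cspace (Suc (Suc n)). z n ^ k * z (Suc n) = 1}"
proof -
  let ?N = "Suc (Suc n)" and ?m = "ord0 n f"
  note lim_f = initial_form_holo_germ(3)[OF f trunc_in_cspace]
  have lim: "(\<lambda>t. stab n k f (\<lambda>i. t * z i) / t ^ Suc k) \<midarrow>0\<rightarrow> z n ^ k * z (Suc n)" for z
  proof (rule Lim_transform_eventually)
    show "(\<lambda>t. t ^ (2 * ?m - Suc k) * (f (\<lambda>i. t * trunc n z i) / t ^ ?m) ^ 2 + z n ^ k * z (Suc n))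
        \<midarrow>0\<rightarrow> z n ^ k * z (Suc n)"
      using tendsto_add[OF tendsto_mult[OF tendsto_null_power[OF tendsto_ident_at]
          tendsto_power[OF lim_f]] tendsto_const] k by fastforce
    show "\<forall>\<^sub>F t in at 0. t ^ (2 * ?m - Suc k) * (f (\<lambda>i. t * trunc n z i) / t ^ ?m) ^ 2
        + z n ^ k * z (Suc n) = stab n k f (\<lambda>i. t * z i) / t ^ Suc k"
      unfolding eventually_at_filter stab_along_ray
      using k by (intro always_eventually)
        (auto simp: power_diff power_divide add_divide_distrib mult.commute simp flip: power_mult)
  qed
  \<comment> \<open>At the point with all \<open>?N\<close> coordinates equal to 1 the monomial
    takes the nonzero value 1.\<close>
  have x: "(\<lambda>i. if i < ?N then 1 else 0) \<in> cspace ?N"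
    by (simp add: cspace_def)
  show "nonzero_germ ?N (stab n k f)"
    by (rule nonzero_germ_limit[OF lim x]) simp
  obtain c where c: "has_expansion ?N (stab n k f) c"
    using holo_germ_stab[OF f(1)] by (auto simp: holo_germ_def)
  show "initial_fibre ?N (stab n k f) = {z \<in> cspace ?N. z n ^ k * z (Suc n) = 1}"
    using initial_form_eqI(2)[OF c lim x] by (auto simp: initial_fibre_def)
qed

subsection \<open>Connectedness of the two fibres\<close>

text \<open>The initial form maps the fibre continuously onto the disconnected set
  \<open>{1, -1}\<close>.\<close>

lemma not_path_connected_square_fibre:
  assumes f: "holo_germ n f" "nonzero_germ n f" and "n \<le> N"
  shows "\<not> path_connected {z \<in> cspace N. initial_form n f (trunc n z) ^ 2 = 1}" (is "\<not> path_connected ?S")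
proof
  assume "path_connected ?S"
  let ?q = "\<lambda>z. initial_form n f (trunc n z)"
  have "continuous_on ?S ?q"
    using continuous_on_compose2[OF initial_form_holo_germ(5)[OF f] continuous_on_trunc] by blast
  then have "connected (?q ` ?S)"
    using \<open>path_connected ?S\<close> connected_continuous_image path_connected_imp_connected by blast
  moreover have sub: "?q ` ?S \<subseteq> {1, -1}" by (auto simp: power2_eq_1_iff)
  moreover have mem: "w \<in> ?q ` ?S" if "w ^ 2 = 1" for w
  proof -
    obtain x where x: "x \<in> cspace n" "initial_form n f x \<noteq> 0"
      using initial_form_holo_germ(1)[OF f] by blast
    \<comment> \<open>By homogeneity, scaling \<open>x\<close> by \<open>t\<close> multiplies the
      initial form by \<open>t ^ ord0 n f\<close>. As the order is positive, a complex root exists,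
      so both signs are attained.\<close>
    obtain t where t: "w / initial_form n f x = t ^ ord0 n f"
      using exists_complex_root initial_form_holo_germ(2)[OF f] by blast
    have "?q (\<lambda>i. t * x i) = w"
      using x t by (simp add: trunc_id cspace_scale initial_form_holo_germ(4)[OF f] flip: t)
    moreover have "(\<lambda>i. t * x i) \<in> cspace N"
      using cspace_scale[OF x(1)] cspace_mono[OF \<open>n \<le> N\<close>] by blast
    ultimately show ?thesis using that by (intro image_eqI[of _ _ "\<lambda>i. t * x i"]) auto
  qed
  ultimately have "connected {1, -1 :: complex}"
    using mem[of 1] mem[of "-1"] by (metis (no_types, lifting) empty_subsetI insert_subset
        one_power2 power2_minus subset_antisym)
  then obtain w where "{1, -1 :: complex} = {w}"
    using connected_finite_iff_sing[of "{1, -1 :: complex}"] by auto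
  from arg_cong[OF this, of card] show False by simp
qed

text \<open>For \<open>k > 0\<close> the coordinate \<open>z n\<close> ranges over the nonzero
  complex numbers and determines \<open>z (Suc n)\<close>, the first \<open>n\<close> coordinates
  being free. Two nonzero numbers are joined by exponentiating the segment between their
  logarithms.\<close>

lemma path_connected_monomial_fibre:
  "path_connected {z \<in> cspace (Suc (Suc n)). z n ^ k * z (Suc n) = 1}" (is "path_connected ?S")
  unfolding path_connected_def
proof (intro ballI)
  fix u w assume u: "u \<in> ?S" and w: "w \<in> ?S"
  show "\<exists>\<gamma>. path \<gamma> \<and> path_image \<gamma> \<subseteq> ?S \<and> pathstart \<gamma> = u \<and> pathfinish \<gamma> = w"
  \<comment> \<open>For \<open>k = 0\<close> the coordinate \<open>z n\<close> may vanish and have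
    no logarithm, but the equation becomes \<open>z (Suc n) = 1\<close>, so the fibre is affine and
    straight segments stay in it.\<close>
  proof (cases "k = 0")
    case True
    let ?\<gamma> = "\<lambda>s i. (1 - complex_of_real s) * u i + complex_of_real s * w i"
    have "path ?\<gamma>" unfolding path_def
      by (rule continuous_on_coordinatewise_then_product) (intro continuous_intros)
    moreover have "path_image ?\<gamma> \<subseteq> ?S"
      using u w True by (auto simp: path_image_def cspace_def)
    ultimately show ?thesis
      by (intro exI[of _ ?\<gamma>]) (simp add: pathstart_def pathfinish_def)
  next
    case False
    define a where "a = Ln (u n)"
    define b where "b = Ln (w n)"
    let ?c = "\<lambda>s. (1 - complex_of_real s) * a + complex_of_real s * b"
    let ?\<gamma> = "\<lambda>s i. if i < n then (1 - complex_of_real s) * u i + complex_of_real s * w i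
      else if i = n then exp (?c s) else if i = Suc n then exp (- (of_nat k * ?c s)) else 0"
    have nz: "u n \<noteq> 0" "w n \<noteq> 0" using u w False by (auto simp: power_0_left)
    \<comment> \<open>On the fibre the last coordinate is the inverse of \<open>v n ^ k\<close>;
      this makes the path start exactly at \<open>u\<close> and end exactly at
      \<open>w\<close>.\<close>
    have last: "v (Suc n) = exp (- (of_nat k * Ln (v n)))" if "v \<in> ?S" "v n \<noteq> 0" for v
      using that by (simp add: exp_minus exp_of_nat_mult field_simps)
    have outside: "v i = 0" if "v \<in> ?S" "\<not> i < n" "i \<noteq> n" "i \<noteq> Suc n" for v i
      using that by (auto simp: cspace_def)
    have "path ?\<gamma>" unfolding path_def
    proof (rule continuous_on_coordinatewise_then_product)
      fix i
      consider "i < n" | "i = n" | "i = Suc n" | "\<not> i < n" "i \<noteq> n" "i \<noteq> Suc n" by blast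
      then show "continuous_on {0..1} (\<lambda>s. ?\<gamma> s i)"
        by cases (simp_all, (intro continuous_intros)+)
    qed
    moreover have "?\<gamma> s \<in> ?S" for s
      by (simp add: cspace_def exp_minus exp_of_nat_mult)
    then have "path_image ?\<gamma> \<subseteq> ?S" by (auto simp: path_image_def)
    moreover have "?\<gamma> 0 = u"
      using last[OF u nz(1)] outside[OF u] nz by (auto simp: a_def)
    moreover have "?\<gamma> 1 = w"
      using last[OF w nz(2)] outside[OF w] nz by (auto simp: b_def)
    ultimately show ?thesis
      unfolding pathstart_def pathfinish_def by blast
  qed
qed

section \<open>Comparison of the orders\<close>

text \<open>Zeroth homology is free on the path components, so (A) makes path connectedness agree on
  the fibres of the two stabilised germs, which contradicts the two preceding lemmas.\<close>

lemma ord0_not_less: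
  assumes A: "\<forall>n\<ge>1. \<forall>f g. holo_germ n f \<and> holo_germ n g \<and> nonzero_germ n f \<and> nonzero_germ n g \<and>
                top_right_equiv n f g \<longrightarrow>
                same_homology (top_of_set (initial_fibre n f)) (top_of_set (initial_fibre n g))"
    and f: "holo_germ n f" "nonzero_germ n f" and g: "holo_germ n g" "nonzero_germ n g"
    and fg: "top_right_equiv n f g"
  shows "\<not> ord0 n f < ord0 n g"
proof
  assume "ord0 n f < ord0 n g"
  \<comment> \<open>The monomial then has the odd degree \<open>2 * ord0 n f + 1\<close>, which lies
    strictly between the even numbers \<open>2 * ord0 n f\<close> and \<open>2 * ord0 n g\<close>
    even if the orders differ by 1.\<close>
  define k where "k = 2 * ord0 n f"
  have k: "2 * ord0 n f < Suc k" "Suc k < 2 * ord0 n g"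
    using \<open>ord0 n f < ord0 n g\<close> by (auto simp: k_def)
  let ?N = "Suc (Suc n)"
  have "same_homology (top_of_set (initial_fibre ?N (stab n k f))) (top_of_set (initial_fibre ?N (stab n k g)))"
    using A holo_germ_stab[OF f(1)] holo_germ_stab[OF g(1)] stab_low_order(1)[OF f k(1)]
      stab_high_order(1)[OF g k(2)] top_right_equiv_stab[OF fg] by simp
  then have "path_connected (initial_fibre ?N (stab n k f)) \<longleftrightarrow> path_connected (initial_fibre ?N (stab n k g))"
    unfolding same_homology_def
    by (metis isomorphic_homology_imp_path_connectedness path_connected_space_euclidean_subtopology)
  then show False
    unfolding stab_low_order(2)[OF f k(1)] stab_high_order(2)[OF g k(2)]
    using not_path_connected_square_fibre[OF f] path_connected_monomial_fibre by auto
qed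

text \<open>Reduced germs are nonzero and the equivalence is symmetric, so neither order can be
  strictly below the other.\<close>

theorem proposition2p3:
  assumes A: "\<forall>n\<ge>1. \<forall>f g. holo_germ n f \<and> holo_germ n g \<and> nonzero_germ n f \<and> nonzero_germ n g \<and>
                top_right_equiv n f g \<longrightarrow>
                same_homology (top_of_set (initial_fibre n f)) (top_of_set (initial_fibre n g))"
  shows "\<forall>n\<ge>1. \<forall>f g. holo_germ n f \<and> holo_germ n g \<and> reduced_germ n f \<and> reduced_germ n g \<and>
           top_right_equiv n f g \<longrightarrow> mult_V n f = mult_V n g"
proof (intro allI impI, elim conjE)
  fix n f g
  assume f: "holo_germ n f" and g: "holo_germ n g" and fg: "top_right_equiv n f g"
    and "reduced_germ n f" "reduced_germ n g"
  then have nz: "nonzero_germ n f" "nonzero_germ n g" by (simp_all add: reduced_germ_def)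
  show "mult_V n f = mult_V n g"
    unfolding mult_V_def
    using ord0_not_less[OF A f nz(1) g nz(2) fg]
      ord0_not_less[OF A g nz(2) f nz(1) top_right_equiv_sym[OF fg]] by simp
qed

end
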